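(* For all complex $a$, $x\neq 0$, $t\neq 0$ for which the integral on the right converges (along the straight segment from $0$ to $t$), $$\sum _{n=0}^{\infty } \frac{t^n L_n^{a}(x)}{(a+n+1)!}=t^{-a-1} \int_0^t e^s s^a (s x)^{-a/2} J_a\left(2 \sqrt{s x}\right) ds .$$
   Context: $L_n^a(x)$ is the generalized Laguerre polynomial, $J_a$ is the Bessel function of the first kind, and for complex $w$ one writes $w!=\Gamma(w+1)$. Powers and square roots are principal values.
   Formalization: The formal theorem additionally assumes that a is not a negative integer; for such a the integral converges but the identity fails, e.g. for a = -1 the left side exceeds the right side by 1. *)

theory Defs
  imports "HOL-Complex_Analysis.Complex_Analysis"
begin

definition cfact :: "complex \<Rightarrow> complex" where
  "cfact w = Gamma (w + 1)"

definition laguerre :: "nat \<Rightarrow> complex \<Rightarrow> complex \<Rightarrow> complex" where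
  "laguerre n a x = (\<Sum>k\<le>n. (-1) ^ k * ((of_nat n + a) gchoose (n - k)) * x ^ k / fact k)"

(* The series uses the entire function rGamma = 1/Gamma, so that the order a may be any complex
   number, negative integers included.  The separate case a = 0 is needed because
   0 powr 0 = 0, whereas bessel_J 0 0 has to be 1. *)
definition bessel_J :: "complex \<Rightarrow> complex \<Rightarrow> complex" where
  "bessel_J a z = (if a = 0 then 1 else (z / 2) powr a) *
     (\<Sum>k. (-1) ^ k * rGamma (a + of_nat k + 1) / fact k * (z\<^sup>2 / 4) ^ k)"

(* Contour integrability along linepath 0 t is Henstock-Kurzweil integrability, which covers
   (also conditionally) convergent improper integrals; the value at the endpoint s = 0 is
   irrelevant.  The integral converges exactly if Re a > -1 or a is a negative integer.  In the
   latter case a = -m the identity needs a correction: the right-hand side is then the sum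
   without its term of index n = m - 1, which is t ^ (m-1) * laguerre (m-1) (-m) x and not zero
   in general; for a = -1 the two sides always differ by 1.  Hence the theorem is stated for a
   not a negative integer. *)
definition laguerre_integrand :: "complex \<Rightarrow> complex \<Rightarrow> complex \<Rightarrow> complex" where
  "laguerre_integrand a x s =
     exp s * s powr a * (s * x) powr (- a / 2) * bessel_J a (2 * csqrt (s * x))"

end

theory Submission
  imports Defs
begin

text \<open>
  Away from \<open>s = 0\<close> the branch-dependent factors \<open>(s x)\<^sup>-\<^sup>a\<^sup>/\<^sup>2\<close> and the prefactor
  \<open>(sqrt (s x))\<^sup>a\<close> of the Bessel function cancel exactly for principal values, so the integrand is
  \<open>s\<^sup>a G(s)\<close> with the entire function \<open>G(s) = exp s * C(-s x)\<close>, where \<open>C\<close> is the Bessel-Clifford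
  function of order \<open>a\<close> (\<open>laguerre_integrand_eq\<close>). Multiplying the two power series gives
  \<open>G(s) = \<Sum>n. c\<^sub>n s\<^sup>n\<close> with \<open>c\<^sub>n = L\<^sub>n\<^sup>a(x) / \<Gamma>(a + n + 1)\<close> (\<open>laguerre_generating_function\<close>), and
  formal integration of \<open>s\<^sup>a\<^sup>+\<^sup>n\<close> divides \<open>c\<^sub>n\<close> by \<open>a + n + 1\<close>, which is the claim.

  The integral may be improper at \<open>0\<close>, and its convergence has to make the lower endpoint contribute
  nothing. With \<open>b = a + 1\<close> and
  \<open>K(s) = \<Sum>n. c\<^sub>n / (b + n) s\<^sup>n\<close>, the function \<open>s\<^sup>b K(s)\<close> is a primitive of the integrand along the
  open segment, so convergence of the integral says that \<open>s\<^sup>b K(s)\<close> has a limit at \<open>0\<close>. As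
  \<open>K(0) = c\<^sub>0 / b\<close> is not zero, \<open>u\<^sup>b\<close> has a limit for real \<open>u \<rightarrow> 0\<close>. Invariance under rescaling of \<open>u\<close>
  forces that limit to be \<open>0\<close> (\<open>tendsto_powr_at_right_0_imp_zero\<close>), hence \<open>s\<^sup>b K(s)\<close> vanishes at \<open>0\<close>
  and the integral is \<open>t\<^sup>b K(t)\<close> (\<open>integral_powr_times_powser\<close>).
\<close>

section \<open>The regular part of the integrand and its power series\<close>

text \<open>
  This is the entire part of the Bessel function:
  \<open>J\<^sub>a(z) = (z/2)\<^sup>a bessel_clifford a (-z\<^sup>2/4)\<close>.
\<close>
definition bessel_clifford :: "complex \<Rightarrow> complex \<Rightarrow> complex" where
  "bessel_clifford a y = (\<Sum>k. rGamma (a + of_nat k + 1) / fact k * y ^ k)"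

lemma summable_norm_bessel_clifford:
  fixes a y :: complex
  shows "summable (\<lambda>k. norm (rGamma (a + of_nat k + 1) / fact k * y ^ k))"
proof -
  \<comment> \<open>From this index on the ratio of consecutive terms, \<open>y / ((a + n + 1) (n + 1))\<close>, is at most \<open>1/2\<close>
      in norm.\<close>
  obtain N where N: "real N \<ge> norm a + 2 * norm y + 1"
    using real_arch_simple by blast
  define f where "f = (\<lambda>k. rGamma (a + of_nat k + 1) / fact k * y ^ k)"
  have "norm (f (Suc n)) \<le> 1/2 * norm (f n)" if "n \<ge> N" for n
  proof -
    have large: "norm (a + of_nat n + 1) \<ge> 2 * norm y + 1"
    proof -
      have "real n + 1 = norm (of_nat n + 1 :: complex)"
        by (metis norm_of_nat of_nat_Suc add.commute)
      also have "\<dots> \<le> norm (a + of_nat n + 1) + norm a"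
        using norm_triangle_ineq4[of "a + of_nat n + 1" a] by (simp add: algebra_simps)
      finally show ?thesis using N that by simp
    qed
    have "(a + of_nat n + 1) * rGamma (a + of_nat (Suc n) + 1) = rGamma (a + of_nat n + 1)"
      using rGamma_plus1[of "a + of_nat n + 1"] by (simp add: algebra_simps)
    then have "f n * y = (a + of_nat n + 1) * rGamma (a + of_nat (Suc n) + 1) / fact n * y ^ Suc n"
      by (simp add: f_def)
    also have "\<dots> = (a + of_nat n + 1) * (of_nat (Suc n)) * f (Suc n)"
      by (simp add: f_def divide_simps del: of_nat_Suc)
    finally have step: "f n * y = (a + of_nat n + 1) * (of_nat (Suc n)) * f (Suc n)" .
    have "norm (f (Suc n)) * (2 * norm y + 1) \<le> norm (f (Suc n)) * norm (a + of_nat n + 1)"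
      using large by (rule mult_left_mono) simp
    also have "\<dots> \<le> norm (f (Suc n)) * norm (a + of_nat n + 1) * real (Suc n)"
      using mult_left_mono[of 1 "real (Suc n)" "norm (f (Suc n)) * norm (a + of_nat n + 1)"] by simp
    also have "\<dots> = norm (f n) * norm y"
      using arg_cong[OF step, of norm] by (simp add: norm_mult mult_ac del: of_nat_Suc)
    also have "\<dots> \<le> norm (f n) * ((2 * norm y + 1) / 2)"
      by (rule mult_left_mono) auto
    finally have "norm (f (Suc n)) * (2 * norm y + 1) \<le> (1/2 * norm (f n)) * (2 * norm y + 1)"
      by simp
    then show ?thesis
      by (rule mult_right_le_imp_le) (metis add_nonneg_pos mult_nonneg_nonneg norm_ge_zero zero_le_numeral zero_less_one)
  qed
  then have "summable (\<lambda>k. norm (f k))"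
    by (intro summable_ratio_test[of "1/2" N]) auto
  then show ?thesis by (simp add: f_def)
qed

text \<open>
  The Gamma quotient in the binomial coefficient \<open>(n + a) gchoose (n - k)\<close> is the Pochhammer symbol
  \<open>(a + k + 1) \<cdots> (a + n)\<close>. Multiplication by \<open>rGamma (a + n + 1)\<close> shortens it to \<open>rGamma (a + k + 1)\<close>,
  for every \<open>a\<close> because \<open>rGamma\<close> is entire. What is left is a convolution.
\<close>
lemma laguerre_times_rGamma:
  "laguerre n a x * rGamma (a + of_nat n + 1)
     = (\<Sum>k\<le>n. rGamma (a + of_nat k + 1) / fact k * (-x) ^ k * (1 / fact (n - k)))"
proof -
  have "((of_nat n + a) gchoose (n - k)) * rGamma (a + of_nat n + 1)
          = rGamma (a + of_nat k + 1) / fact (n - k)" if "k \<le> n" for k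
  proof -
    have "(of_nat n + a) gchoose (n - k)
            = pochhammer (a + of_nat k + 1) (n - k) / fact (n - k)"
      using that by (simp add: gbinomial_pochhammer' of_nat_diff algebra_simps)
    moreover have "rGamma (a + of_nat k + 1)
        = pochhammer (a + of_nat k + 1) (n - k) * rGamma (a + of_nat n + 1)"
      using that pochhammer_rGamma[of "a + of_nat k + 1" "n - k"]
      by (simp add: of_nat_diff algebra_simps)
    ultimately show ?thesis by simp
  qed
  then have "(-1) ^ k * ((of_nat n + a) gchoose (n - k)) * x ^ k / fact k * rGamma (a + of_nat n + 1)
        = rGamma (a + of_nat k + 1) / fact k * (-x) ^ k * (1 / fact (n - k))" if "k \<le> n" for k
    using that by (simp add: power_minus[of x] field_simps)
  then show ?thesis
    unfolding laguerre_def sum_distrib_right by (intro sum.cong) auto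
qed

text \<open>
  By the previous lemma the coefficients are those of the Cauchy product of the exponential and the
  Bessel-Clifford series.
\<close>
lemma laguerre_generating_function:
  "(\<lambda>n. laguerre n a x * rGamma (a + of_nat n + 1) * s ^ n) sums
     (exp s * bessel_clifford a (- (s * x)))"
proof -
  define f where "f = (\<lambda>k. rGamma (a + of_nat k + 1) / fact k * (- (s * x)) ^ k)"
  define g where "g = (\<lambda>k. s ^ k /\<^sub>R fact k)"
  have g: "g k = s ^ k / fact k" for k
    by (simp add: g_def scaleR_conv_of_real field_simps)
  have "(\<lambda>n. \<Sum>k\<le>n. f k * g (n - k)) sums ((\<Sum>k. f k) * (\<Sum>k. g k))"
    unfolding f_def g_def
    by (intro Cauchy_product_sums summable_norm_bessel_clifford summable_norm_exp)
  moreover have "(\<Sum>k\<le>n. f k * g (n - k)) = laguerre n a x * rGamma (a + of_nat n + 1) * s ^ n" for n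
    unfolding laguerre_times_rGamma sum_distrib_right
  proof (intro sum.cong refl)
    fix k assume "k \<in> {..n}"
    then have "s ^ n = s ^ k * s ^ (n - k)"
      by (simp flip: power_add)
    moreover have "(- (s * x)) ^ k = s ^ k * (- x) ^ k"
      by (metis mult_minus_right power_mult_distrib)
    ultimately show "f k * g (n - k) = rGamma (a + of_nat k + 1) / fact k * (-x) ^ k * (1 / fact (n - k)) * s ^ n"
      by (simp add: f_def g)
  qed
  ultimately show ?thesis
    by (simp add: f_def g_def exp_def bessel_clifford_def mult.commute)
qed

text \<open>
  The cancellation holds on all branches because the principal square root halves the principal
  logarithm: \<open>Ln (csqrt z) = Ln z / 2\<close>, hence \<open>csqrt z powr a = z powr (a / 2)\<close>.
\<close>
lemma laguerre_integrand_eq: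
  assumes "s \<noteq> 0" "x \<noteq> 0"
  shows "laguerre_integrand a x s = s powr a * (exp s * bessel_clifford a (- (s * x)))"
proof -
  have nz: "s * x \<noteq> 0" using assms by simp
  have arg: "(2 * csqrt (s * x))\<^sup>2 / 4 = s * x"
    by (simp add: power_mult_distrib)
  have series: "(\<Sum>k. (-1) ^ k * rGamma (a + of_nat k + 1) / fact k * (s * x) ^ k)
      = bessel_clifford a (- (s * x))"
    unfolding bessel_clifford_def
    by (rule arg_cong[where f = suminf]) (simp add: fun_eq_iff power_minus[of "s * x"] mult_ac)
  have "Ln (csqrt (s * x)) = Ln (s * x) / 2"
    unfolding csqrt_exp_Ln[OF nz] using mpi_less_Im_Ln[OF nz] Im_Ln_le_pi[OF nz]
    by (intro Ln_exp) (use pi_gt_zero in auto)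
  then have "csqrt (s * x) powr a = (s * x) powr (a / 2)"
    using nz by (simp only: powr_def csqrt_eq_0 if_False mult.commute times_divide_eq_left times_divide_eq_right)
  then have "(s * x) powr (- a / 2) * csqrt (s * x) powr a = 1"
    using nz by (simp flip: powr_add)
  then have "(s * x) powr (- a / 2) * (if a = 0 then 1 else (2 * csqrt (s * x) / 2) powr a) = 1"
    using nz by auto
  then show ?thesis
    unfolding laguerre_integrand_def bessel_J_def arg series
    by (simp add: mult_ac)
qed

section \<open>Limits of complex powers at the origin\<close>

text \<open>
  Replacing \<open>u\<close> by \<open>r u\<close> does not change the limit but multiplies the function by \<open>r\<^sup>b\<close>, so
  \<open>r\<^sup>b l = l\<close> for every \<open>r > 0\<close>. As \<open>b \<noteq> 0\<close>, some \<open>r\<close> has \<open>r\<^sup>b \<noteq> 1\<close>. An oscillating power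
  (\<open>Re b = 0\<close>) is thus covered in the same way as an unbounded one.
\<close>
lemma tendsto_powr_at_right_0_imp_zero:
  fixes b l :: complex
  assumes lim: "((\<lambda>u. of_real u powr b) \<longlongrightarrow> l) (at_right 0)" and "b \<noteq> 0"
  shows "l = 0"
proof -
  \<comment> \<open>The power \<open>r powr b\<close> is the exponential of a number of norm 1, whereas nonzero periods of \<open>exp\<close>
      have norm at least \<open>2 pi\<close>.\<close>
  define r where "r = exp (1 / norm b)"
  have r: "r > 0" "of_real r powr b = exp (b / norm b)"
    by (simp_all add: r_def powr_def Ln_of_real field_simps)
  have "((\<lambda>u. of_real (r * u) powr b) \<longlongrightarrow> l) (at_right 0)"
  proof (rule filterlim_compose[OF lim])
    show "filterlim (\<lambda>u. r * u) (at_right 0) (at_right (0::real))"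
      unfolding filterlim_at using r(1)
      by (auto intro!: tendsto_eq_intros eventually_mono[OF eventually_at_right_less])
  qed
  moreover have "((\<lambda>u. of_real (r * u) powr b) \<longlongrightarrow> of_real r powr b * l) (at_right 0)"
  proof (rule Lim_transform_eventually)
    show "((\<lambda>u. of_real r powr b * of_real u powr b) \<longlongrightarrow> of_real r powr b * l) (at_right 0)"
      by (intro tendsto_intros lim)
    show "\<forall>\<^sub>F u in at_right 0. of_real r powr b * of_real u powr b = of_real (r * u) powr b"
      using eventually_at_right_less
      by eventually_elim (use r(1) in \<open>simp add: powr_times_real\<close>)
  qed
  ultimately have "of_real r powr b * l = l"
    using tendsto_unique trivial_limit_at_right_real by blast
  moreover have "of_real r powr b \<noteq> 1"
  proof
    assume "of_real r powr b = 1"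
    then have "exp (b / norm b) = 1" using r by simp
    then obtain n :: int where n: "Re (b / norm b) = 0" "Im (b / norm b) = of_int (2 * n) * pi"
      unfolding exp_eq_1 by auto
    have one: "norm (b / norm b) = 1" using \<open>b \<noteq> 0\<close> by (simp add: norm_divide)
    then have "\<bar>of_int (2 * n) * pi\<bar> = 1"
      using n by (metis cmod_eq_Im)
    then have "real_of_int \<bar>2 * n\<bar> * pi = 1" by (simp add: abs_mult)
    moreover have "n \<noteq> 0 \<Longrightarrow> real_of_int \<bar>2 * n\<bar> * pi \<ge> 1 * pi"
      by (intro mult_right_mono) auto
    ultimately show False using pi_gt3 by (cases "n = 0") auto
  qed
  ultimately show "l = 0" by auto
qed

section \<open>Integrating a power times a power series\<close>

lemma summable_divide_shift:
  fixes b s :: complex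
  assumes "\<And>s. summable (\<lambda>n. c n * s ^ n)"
  shows "summable (\<lambda>n. c n / (b + of_nat n) * s ^ n)"
proof (rule summable_comparison_test)
  show "summable (\<lambda>n. norm (c n * s ^ n))"
    by (rule powser_insidea[OF assms[of "of_real (norm s + 1)"]]) (simp add: abs_if)
  obtain N where N: "real N \<ge> norm b + 1"
    using real_arch_simple by blast
  have "norm (c n / (b + of_nat n) * s ^ n) \<le> norm (c n * s ^ n)" if "n \<ge> N" for n
  proof -
    have "norm (b + of_nat n) \<ge> 1"
      using norm_triangle_ineq4[of "b + of_nat n" b] N that by simp
    then have "norm (c n * s ^ n) / norm (b + of_nat n) \<le> norm (c n * s ^ n) / 1"
      by (intro divide_left_mono) (auto intro: order.strict_trans2[of 0 1])
    then show ?thesis by (simp add: norm_mult norm_divide)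
  qed
  then show "\<exists>N. \<forall>n\<ge>N. norm (c n / (b + of_nat n) * s ^ n) \<le> norm (c n * s ^ n)"
    by blast
qed

text \<open>
  The Euler operator \<open>b + s d/ds\<close> multiplies \<open>s\<^sup>n\<close> by \<open>b + n\<close> and so undoes the division of the
  coefficients. This equation says that \<open>s\<^sup>b K(s)\<close> has derivative \<open>s\<^sup>b\<^sup>-\<^sup>1 G(s)\<close>.
\<close>
lemma powser_divide_shift_ode:
  fixes b s :: complex
  assumes G: "\<And>s. (\<lambda>n. c n * s ^ n) sums G s"
    and b: "\<And>n. b + of_nat n \<noteq> 0"
  defines "K \<equiv> \<lambda>s. \<Sum>n. c n / (b + of_nat n) * s ^ n"
  obtains D where "(K has_field_derivative D) (at s)" "b * K s + s * D = G s"
proof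
  define d where "d = (\<lambda>n. c n / (b + of_nat n))"
  have d: "summable (\<lambda>n. d n * s ^ n)" for s
    unfolding d_def by (rule summable_divide_shift) (use G in \<open>auto simp: sums_iff\<close>)
  show "(K has_field_derivative (\<Sum>n. diffs d n * s ^ n)) (at s)"
    using termdiffs_strong_converges_everywhere[OF d] by (simp add: K_def d_def)
  have "(\<lambda>n. of_nat n * d n * s ^ (n - Suc 0)) sums (\<Sum>n. diffs d n * s ^ n)"
    by (intro diffs_equiv termdiff_converges_all d)
  then have "(\<lambda>n. s * (of_nat n * d n * s ^ (n - Suc 0))) sums (s * (\<Sum>n. diffs d n * s ^ n))"
    by (rule sums_mult)
  moreover have "s * (of_nat n * d n * s ^ (n - Suc 0)) = of_nat n * d n * s ^ n" for n
    by (cases n) (auto simp: mult_ac)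
  ultimately have "(\<lambda>n. of_nat n * d n * s ^ n) sums (s * (\<Sum>n. diffs d n * s ^ n))"
    by (simp only:)
  then have "(\<lambda>n. b * (d n * s ^ n) + of_nat n * d n * s ^ n) sums
      (b * K s + s * (\<Sum>n. diffs d n * s ^ n))"
    using summable_sums[OF d, of s] by (intro sums_add sums_mult) (simp_all add: K_def d_def)
  moreover have "b * (d n * s ^ n) + of_nat n * d n * s ^ n = c n * s ^ n" for n
  proof -
    have "b * (d n * s ^ n) + of_nat n * d n * s ^ n = (b + of_nat n) * d n * s ^ n"
      by (simp add: algebra_simps)
    then show ?thesis using b[of n] by (simp add: d_def)
  qed
  ultimately have "(\<lambda>n. c n * s ^ n) sums (b * K s + s * (\<Sum>n. diffs d n * s ^ n))"
    by (simp only:)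
  then show "b * K s + s * (\<Sum>n. diffs d n * s ^ n) = G s"
    using G sums_unique2 by blast
qed

text \<open>
  Existence of the Henstock-Kurzweil integral takes the place of a condition on \<open>Re b\<close>: it makes
  \<open>u\<^sup>b K(u t)\<close> converge as \<open>u \<rightarrow> 0\<close>, and \<open>c 0 \<noteq> 0\<close> transfers this to \<open>u\<^sup>b\<close>, whose limit can only be
  \<open>0\<close>. The power is taken of the real parameter \<open>u\<close> only, so that the branch cut does not interfere
  with differentiation when the segment from \<open>0\<close> to \<open>t\<close> lies on the negative real axis.
\<close>
lemma integral_powr_times_powser:
  fixes b t :: complex
  assumes G: "\<And>s. (\<lambda>n. c n * s ^ n) sums G s"
    and b: "\<And>n. b + of_nat n \<noteq> 0" and "c 0 \<noteq> 0"
    and I: "((\<lambda>u. of_real u powr (b - 1) * G (of_real u * t)) has_integral I) {0..1}"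
  shows "I = (\<Sum>n. c n / (b + of_nat n) * t ^ n)"
proof -
  define K where "K = (\<lambda>s. \<Sum>n. c n / (b + of_nat n) * s ^ n)"
  define \<Phi> where "\<Phi> = (\<lambda>w. w powr b * K (w * t))"
  define f where "f = (\<lambda>u. of_real u powr (b - 1) * G (of_real u * t))"
  have deriv: "((\<lambda>u. \<Phi> (of_real u)) has_vector_derivative f u) (at u within S)" if "u > 0" for u S
  proof -
    define w where "w = complex_of_real u"
    have w: "w \<notin> \<real>\<^sub>\<le>\<^sub>0" "w \<noteq> 0" using that by (auto simp: w_def)
    obtain D where D: "(K has_field_derivative D) (at (w * t))"
        "b * K (w * t) + w * t * D = G (w * t)"
      using powser_divide_shift_ode[OF G b] unfolding K_def by blast
    have "((\<lambda>w. K (w * t)) has_field_derivative D * t) (at w)"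
      using DERIV_chain2[where g = "\<lambda>w. w * t", OF D(1)] DERIV_cmult_right[OF DERIV_ident, of t w]
      by simp
    from DERIV_mult[OF has_field_derivative_powr[OF w(1), of b] this]
    have "(\<Phi> has_field_derivative w powr (b - 1) * (b * K (w * t) + w * t * D)) (at w)"
      unfolding \<Phi>_def using w by (simp add: algebra_simps powr_diff)
    then have "(\<Phi> has_field_derivative f u) (at (of_real u))"
      using D by (simp add: f_def w_def)
    then show ?thesis
      by (rule has_vector_derivative_real_field)
  qed
  have K_cont: "isCont K s" for s
    using powser_divide_shift_ode[OF G b, of s] DERIV_isCont unfolding K_def by metis
  have K0: "K 0 \<noteq> 0"
    using \<open>c 0 \<noteq> 0\<close> b[of 0] powser_zero[of "\<lambda>n. c n / (b + of_nat n)"] by (simp add: K_def)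

  have part: "integral {e..1} f = \<Phi> 1 - \<Phi> (of_real e)" if "0 < e" "e < 1" for e
    using fundamental_theorem_of_calculus[of e 1 "\<lambda>u. \<Phi> (of_real u)" f] deriv that
    by (intro integral_unique) auto
  \<comment> \<open>Henstock-Kurzweil integrals depend continuously on the lower endpoint, even if the integrand is
      unbounded there.\<close>
  have "continuous_on {0..1} (\<lambda>e. integral {e..1} f)"
    by (rule indefinite_integral_continuous_1') (use I f_def in blast)
  then have "((\<lambda>e. integral {e..1} f) \<longlongrightarrow> integral {0..1} f) (at_right 0)"
    using continuous_on_Icc_at_rightD[of 0 1 "\<lambda>e. integral {e..1} f"] by simp
  moreover have "integral {0..1} f = I"
    using I by (auto simp: f_def)
  ultimately have "((\<lambda>e. integral {e..1} f) \<longlongrightarrow> I) (at_right 0)" by simp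
  then have "((\<lambda>e. \<Phi> 1 - integral {e..1} f) \<longlongrightarrow> \<Phi> 1 - I) (at_right 0)"
    by (intro tendsto_intros)
  moreover have "\<forall>\<^sub>F e in at_right 0. \<Phi> 1 - integral {e..1} f = \<Phi> (of_real e)"
    using eventually_at_right_less eventually_at_right_real[of 0 1]
    by (auto elim!: eventually_mono simp: part)
  ultimately have \<Phi>_lim: "((\<lambda>e. \<Phi> (of_real e)) \<longlongrightarrow> \<Phi> 1 - I) (at_right 0)"
    by (rule Lim_transform_eventually)

  have "((\<lambda>u. complex_of_real u * t) \<longlongrightarrow> of_real 0 * t) (at_right 0)"
    by (intro tendsto_intros)
  then have K_lim: "((\<lambda>u. K (of_real u * t)) \<longlongrightarrow> K 0) (at_right 0)"
    by (intro isCont_tendsto_compose[OF K_cont]) auto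
  have "((\<lambda>u. of_real u powr b) \<longlongrightarrow> (\<Phi> 1 - I) / K 0) (at_right 0)"
  proof (rule Lim_transform_eventually)
    show "((\<lambda>u. \<Phi> (of_real u) / K (of_real u * t)) \<longlongrightarrow> (\<Phi> 1 - I) / K 0) (at_right 0)"
      by (intro tendsto_intros \<Phi>_lim K_lim K0)
    show "\<forall>\<^sub>F u in at_right 0. \<Phi> (of_real u) / K (of_real u * t) = of_real u powr b"
      using tendsto_imp_eventually_ne[OF K_lim K0]
      by eventually_elim (simp add: \<Phi>_def)
  qed
  then have "(\<Phi> 1 - I) / K 0 = 0"
    by (rule tendsto_powr_at_right_0_imp_zero) (use b[of 0] in simp)
  then show ?thesis
    using K0 by (simp add: \<Phi>_def K_def)
qed

section \<open>The Laguerre series as a Bessel integral\<close>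

theorem theorem4p86:
  fixes a x t :: complex
  assumes "x \<noteq> 0" and "t \<noteq> 0"
    and "a + 1 \<notin> \<int>\<^sub>\<le>\<^sub>0"
    and "laguerre_integrand a x contour_integrable_on linepath 0 t"
  shows "(\<lambda>n. t ^ n * laguerre n a x / cfact (a + of_nat n + 1)) sums
           (t powr (- a - 1) * contour_integral (linepath 0 t) (laguerre_integrand a x))"
proof -
  define c where "c = (\<lambda>n. laguerre n a x * rGamma (a + of_nat n + 1))"
  define G where "G = (\<lambda>s. exp s * bessel_clifford a (- (s * x)))"
  define J where "J = contour_integral (linepath 0 t) (laguerre_integrand a x)"
  have G: "(\<lambda>n. c n * s ^ n) sums G s" for s
    using laguerre_generating_function by (simp add: c_def G_def)
  have b: "a + 1 + of_nat n \<noteq> 0" for n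
    using assms(3) by (metis add_eq_0_iff2 nonpos_Ints_of_int minus_of_nat_in_nonpos_Ints)
  have c0: "c 0 \<noteq> 0"
    using assms(3) by (simp add: c_def laguerre_def rGamma_eq_zero_iff)
  have "((\<lambda>u. laguerre_integrand a x (linepath 0 t u) * t) has_integral J) {0..1}"
    using has_contour_integral_integral[OF assms(4)]
    by (simp add: has_contour_integral_linepath J_def)
  then have "((\<lambda>u. t powr (- a - 1) * (laguerre_integrand a x (linepath 0 t u) * t))
      has_integral t powr (- a - 1) * J) {0..1}"
    by (rule has_integral_mult_right)
  moreover have "t powr (- a - 1) * (laguerre_integrand a x (linepath 0 t u) * t)
      = of_real u powr (a + 1 - 1) * G (of_real u * t)" if "u \<in> {0..1} - {0}" for u
  proof -
    have u: "u > 0" using that by simp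
    then have "(of_real u * t) powr a = of_real u powr a * t powr a"
      by (intro powr_times_real_left) auto
    moreover have "t powr (- a - 1) * t powr a * t = 1"
      using assms(2) by (simp add: powr_diff powr_minus)
    moreover have "linepath 0 t u = of_real u * t"
      by (simp add: linepath_def scaleR_conv_of_real)
    ultimately show ?thesis
      using laguerre_integrand_eq[of "of_real u * t" x a] u assms(1,2)
      by (simp add: G_def mult_ac)
  qed
  ultimately have "((\<lambda>u. of_real u powr (a + 1 - 1) * G (of_real u * t))
      has_integral t powr (- a - 1) * J) {0..1}"
    using has_integral_spike_finite[of "{0}" "{0..1}"] by (metis (lifting) finite.emptyI finite.insertI)
  then have "t powr (- a - 1) * J = (\<Sum>n. c n / (a + 1 + of_nat n) * t ^ n)"
    by (intro integral_powr_times_powser[OF G b c0])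
  moreover have "summable (\<lambda>n. c n / (a + 1 + of_nat n) * t ^ n)"
    using summable_divide_shift G by (blast intro: sums_summable)
  ultimately have "(\<lambda>n. c n / (a + 1 + of_nat n) * t ^ n) sums (t powr (- a - 1) * J)"
    by (simp add: sums_iff)
  moreover have "c n / (a + 1 + of_nat n) * t ^ n = t ^ n * laguerre n a x / cfact (a + of_nat n + 1)" for n
  proof -
    have "rGamma (a + of_nat n + 1) = (a + 1 + of_nat n) * rGamma (a + of_nat n + 1 + 1)"
      using rGamma_plus1[of "a + of_nat n + 1"] by (simp add: add_ac)
    then have "c n / (a + 1 + of_nat n) = laguerre n a x * rGamma (a + of_nat n + 1 + 1)"
      using b[of n] by (simp add: c_def)
    then show ?thesis
      by (simp add: cfact_def Gamma_def field_simps)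
  qed
  ultimately show ?thesis
    by (simp add: J_def)
qed

end
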